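(* Let $\mathcal J=(M,\lambda,\tau)$ be a noetherian reduction structure with disjoint cones and well-founded order $\prec$. Suppose that for all $x^\delta,x^{\delta'},x^\varepsilon\in\mathcal T$, $x^\delta\succ x^{\delta'}$ implies $x^{\delta+\varepsilon}\succ x^{\delta'+\varepsilon}\succeq x^\varepsilon$. Let $\mathcal F$ be a marked set over $\mathcal J$. Then, in testing whether $\mathcal F$ is a marked basis, it is not necessary to check whether the S-polynomials $S(f_{\alpha'},f_\alpha)$ with $\operatorname{lcm}(x^\alpha,x^{\alpha'})=x^{\alpha+\alpha'}$ reduce to $0$. That is, $\mathcal F$ is a marked basis if and only if $S(f_{\alpha'},f_\alpha)\rightarrow^+_{\mathcal F\mathcal J}0\downarrow$ for all $x^\alpha,x^{\alpha'}\in M$ such that $\operatorname{lcm}(x^\alpha,x^{\alpha'})\in\operatorname{cone}(x^{\alpha'})$ and $\operatorname{lcm}(x^\alpha,x^{\alpha'})\neq x^{\alpha+\alpha'}$.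
   Context: Let $A$ be a field, $\mathcal P=A[x_1,\dots,x_n]$, and $\mathcal T$ the set of terms $x^\alpha=x_1^{\alpha_1}\cdots x_n^{\alpha_n}$, $\alpha\in\mathbb N^n$. $\operatorname{Supp}(g)\subset\mathcal T$ is the set of terms with nonzero coefficient in $g$; $\langle V\rangle$ is the $A$-span of $V\subset\mathcal P$ and $(V)$ the ideal of $\mathcal P$ generated by $V$. A semigroup ideal is a subset of $\mathcal T$ closed under multiplication by terms; an order ideal is the complement in $\mathcal T$ of a semigroup ideal. A reduction structure (RS) is a triple $\mathcal J=(M,\lambda=\{\lambda_\alpha\}_{x^\alpha\in M},\tau=\{\tau_\alpha\}_{x^\alpha\in M})$ where $M\subset\mathcal T$ is finite, $J$ denotes the semigroup ideal generated by $M$, each $\tau_\alpha\subseteq\mathcal T$ is an order ideal, $\operatorname{cone}(x^\alpha)=\{x^{\alpha+\eta}: x^\eta\in\tau_\alpha\}$, $\bigcup_{x^\alpha\in M}\operatorname{cone}(x^\alpha)=J$, and $\lambda_\alpha\subseteq\mathcal T\setminus\operatorname{cone}(x^\alpha)$. $\mathsf N(J)=\mathcal T\setminus J$. All RSs are assumed to have finite tails: every $\lambda_\alpha$ is finite. $\mathcal J$ has disjoint cones if $\operatorname{cone}(x^\alpha)\cap\operatorname{cone}(x^{\alpha'})=\emptyset$ for distinct $x^\alpha,x^{\alpha'}\in M$. A marked set over $\mathcal J$ is a set $\mathcal F=\{f_\alpha\}_{x^\alpha\in M}\subset\mathcal P$ such that $x^\alpha$ has coefficient $1$ in $f_\alpha$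 and $\operatorname{Supp}(f_\alpha-x^\alpha)\subset\lambda_\alpha$. It is a marked basis if $(\mathcal F)\oplus\langle\mathsf N(J)\rangle=\mathcal P$. The S-polynomial is $S(f_{\alpha'},f_\alpha)=x^\eta f_\alpha-x^{\eta'}f_{\alpha'}$, where $x^{\eta+\alpha}=x^{\eta'+\alpha'}=\operatorname{lcm}(x^\alpha,x^{\alpha'})$. One-step reduction: $g\rightarrow_{\mathcal F\mathcal J}h$ if there are $x^\gamma\in\operatorname{Supp}(g)$ with coefficient $c$ in $g$, $x^\alpha\in M$ and $x^\eta\in\tau_\alpha$ with $x^\gamma=x^{\alpha+\eta}$ and $h=g-cx^\eta f_\alpha$. $\rightarrow^+_{\mathcal F\mathcal J}$ is the reflexive-transitive closure. $g\rightarrow^+_{\mathcal F\mathcal J}l\downarrow$ means $g\rightarrow^+_{\mathcal F\mathcal J}l$ and $\operatorname{Supp}(l)\subset\mathsf N(J)$. $\mathcal J$ is noetherian if for every marked set over it there is no infinite chain of one-step reductions. $\mathcal J$ is ordered by a well-founded order $\prec$ on $\mathcal T$ (a strict partial order for which every nonempty subset has minimal elements) if $x^{\gamma+\eta}\prec x^{\alpha+\eta}$ for all $x^\alpha\in M$, $x^\gamma\in\lambda_\alpha$, $x^\eta\in\tau_\alpha$. Noetherian and ordered are treated as synonyms, and a noetherian $\mathcal J$ comes with a fixed such order $\prec$. *)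

theory Defs
  imports Complex_Main "HOL-Library.Poly_Mapping"
begin

text \<open>
  A term \<open>x\<^sup>\<alpha>\<close> is represented by its exponent vector \<open>\<alpha>\<close>, so the product of terms is addition
  of exponents and the term \<open>1\<close> is \<open>0\<close>. The finite type \<open>'n\<close> indexes the variables, and
  \<open>('n, 'a) mpoly\<close> with the convolution product of \<open>Poly_Mapping\<close> is
  \<open>\<P> = A[x\<^sub>1, \<dots>, x\<^sub>n]\<close>; \<open>Supp\<close> is \<open>Poly_Mapping.keys\<close>.
\<close>

type_synonym 'n pterm = "'n \<Rightarrow>\<^sub>0 nat"
type_synonym ('n, 'a) mpoly = "'n pterm \<Rightarrow>\<^sub>0 'a"

lift_definition lcm_term :: "'n pterm \<Rightarrow> 'n pterm \<Rightarrow> 'n pterm"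
  is "\<lambda>s t i. max (s i) (t i)"
proof -
  fix s t :: "'n \<Rightarrow> nat"
  assume "finite {i. s i \<noteq> 0}" and "finite {i. t i \<noteq> 0}"
  then have "finite ({i. s i \<noteq> 0} \<union> {i. t i \<noteq> 0})"
    by simp
  then show "finite {i. max (s i) (t i) \<noteq> 0}"
    by (rule rev_finite_subset) auto
qed

definition semigroup_ideal :: "'n pterm set \<Rightarrow> bool" where
  "semigroup_ideal S \<longleftrightarrow> (\<forall>s\<in>S. \<forall>t. s + t \<in> S)"

definition order_ideal :: "'n pterm set \<Rightarrow> bool" where
  "order_ideal T \<longleftrightarrow> semigroup_ideal (- T)"

definition poly_ideal :: "('n, 'a::field) mpoly set \<Rightarrow> ('n, 'a) mpoly set" where
  "poly_ideal V = module.span (*) V"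

definition linear_span :: "('n, 'a::field) mpoly set \<Rightarrow> ('n, 'a) mpoly set" where
  "linear_span V = module.span (\<lambda>c p. Poly_Mapping.single 0 c * p) V"

lemma module_mult: "module ((*) :: ('n, 'a::field) mpoly \<Rightarrow> _)"
  by unfold_locales (simp_all add: algebra_simps)

lemma vector_space_scale:
  "vector_space (\<lambda>(c::'a::field) (p::('n, 'a) mpoly). Poly_Mapping.single 0 c * p)"
  by unfold_locales
    (simp_all add: algebra_simps single_add mult_single flip: mult.assoc)

definition is_direct_sum :: "'b::ab_group_add set \<Rightarrow> 'b set \<Rightarrow> 'b set \<Rightarrow> bool" where
  "is_direct_sum U V W \<longleftrightarrow> U \<inter> V = {0} \<and> {u + v |u v. u \<in> U \<and> v \<in> V} = W"

text \<open>The functions \<open>tails\<close> (\<open>\<lambda>\<close>) and \<open>mults\<close> (\<open>\<tau>\<close>) are only meaningful on \<open>heads\<close> (\<open>M\<close>).\<close>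

record 'n red_struct =
  heads :: "'n pterm set"
  tails :: "'n pterm \<Rightarrow> 'n pterm set"
  mults :: "'n pterm \<Rightarrow> 'n pterm set"

definition rs_cone :: "'n red_struct \<Rightarrow> 'n pterm \<Rightarrow> 'n pterm set" where
  "rs_cone J \<alpha> = {\<alpha> + \<eta> |\<eta>. \<eta> \<in> mults J \<alpha>}"

definition rs_ideal :: "'n red_struct \<Rightarrow> 'n pterm set" where
  "rs_ideal J = semigroup_ideal hull heads J"

definition rs_normal_terms :: "'n red_struct \<Rightarrow> 'n pterm set" where
  "rs_normal_terms J = - rs_ideal J"

definition reduction_structure :: "'n red_struct \<Rightarrow> bool" where
  "reduction_structure J \<longleftrightarrow>
     finite (heads J) \<and>
     (\<forall>\<alpha>\<in>heads J. order_ideal (mults J \<alpha>)) \<and>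
     (\<Union>\<alpha>\<in>heads J. rs_cone J \<alpha>) = rs_ideal J \<and>
     (\<forall>\<alpha>\<in>heads J. tails J \<alpha> \<subseteq> - rs_cone J \<alpha>) \<and>
     (\<forall>\<alpha>\<in>heads J. finite (tails J \<alpha>))"

definition disjoint_cones :: "'n red_struct \<Rightarrow> bool" where
  "disjoint_cones J \<longleftrightarrow>
     (\<forall>\<alpha>\<in>heads J. \<forall>\<alpha>'\<in>heads J. \<alpha> \<noteq> \<alpha>' \<longrightarrow> rs_cone J \<alpha> \<inter> rs_cone J \<alpha>' = {})"

text \<open>A marked set is a family \<open>f\<close> indexed by terms; only its members at \<open>heads J\<close> matter.\<close>

definition marked_set :: "'n red_struct \<Rightarrow> ('n pterm \<Rightarrow> ('n, 'a::field) mpoly) \<Rightarrow> bool" where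
  "marked_set J f \<longleftrightarrow>
     (\<forall>\<alpha>\<in>heads J. Poly_Mapping.lookup (f \<alpha>) \<alpha> = 1 \<and>
        Poly_Mapping.keys (f \<alpha> - Poly_Mapping.single \<alpha> 1) \<subseteq> tails J \<alpha>)"

definition marked_basis :: "'n red_struct \<Rightarrow> ('n pterm \<Rightarrow> ('n, 'a::field) mpoly) \<Rightarrow> bool" where
  "marked_basis J f \<longleftrightarrow>
     is_direct_sum (poly_ideal (f ` heads J))
       (linear_span ((\<lambda>t. Poly_Mapping.single t 1) ` rs_normal_terms J)) UNIV"

text \<open>Subtraction of exponents is truncated, but here exact, since both terms divide their lcm.\<close>

definition S_poly ::
  "('n pterm \<Rightarrow> ('n, 'a::field) mpoly) \<Rightarrow> 'n pterm \<Rightarrow> 'n pterm \<Rightarrow> ('n, 'a) mpoly" where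
  "S_poly f \<alpha>' \<alpha> =
     Poly_Mapping.single (lcm_term \<alpha> \<alpha>' - \<alpha>) 1 * f \<alpha> -
     Poly_Mapping.single (lcm_term \<alpha> \<alpha>' - \<alpha>') 1 * f \<alpha>'"

definition red_step ::
  "'n red_struct \<Rightarrow> ('n pterm \<Rightarrow> ('n, 'a::field) mpoly) \<Rightarrow>
     ('n, 'a) mpoly \<Rightarrow> ('n, 'a) mpoly \<Rightarrow> bool" where
  "red_step J f g h \<longleftrightarrow>
     (\<exists>\<gamma>\<in>Poly_Mapping.keys g. \<exists>\<alpha>\<in>heads J. \<exists>\<eta>\<in>mults J \<alpha>.
        \<gamma> = \<alpha> + \<eta> \<and> h = g - Poly_Mapping.single \<eta> (Poly_Mapping.lookup g \<gamma>) * f \<alpha>)"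

definition reduces_to_nf ::
  "'n red_struct \<Rightarrow> ('n pterm \<Rightarrow> ('n, 'a::field) mpoly) \<Rightarrow>
     ('n, 'a) mpoly \<Rightarrow> ('n, 'a) mpoly \<Rightarrow> bool" where
  "reduces_to_nf J f g l \<longleftrightarrow>
     (red_step J f)\<^sup>*\<^sup>* g l \<and> Poly_Mapping.keys l \<subseteq> rs_normal_terms J"

text \<open>Noetherianity quantifies over marked sets, hence depends on the coefficient field.\<close>

definition noetherian_rs :: "'a::field itself \<Rightarrow> 'n red_struct \<Rightarrow> bool" where
  "noetherian_rs (A :: 'a itself) J \<longleftrightarrow>
     (\<forall>f :: 'n pterm \<Rightarrow> ('n, 'a) mpoly. marked_set J f \<longrightarrow>
        \<not> (\<exists>g. \<forall>i::nat. red_step J f (g i) (g (Suc i))))"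

definition well_founded_order :: "('b \<Rightarrow> 'b \<Rightarrow> bool) \<Rightarrow> bool" where
  "well_founded_order r \<longleftrightarrow> irreflp r \<and> transp r \<and> wfp r"

definition ordered_rs :: "'n red_struct \<Rightarrow> ('n pterm \<Rightarrow> 'n pterm \<Rightarrow> bool) \<Rightarrow> bool" where
  "ordered_rs J prec \<longleftrightarrow>
     well_founded_order prec \<and>
     (\<forall>\<alpha>\<in>heads J. \<forall>\<gamma>\<in>tails J \<alpha>. \<forall>\<eta>\<in>mults J \<alpha>. prec (\<gamma> + \<eta>) (\<alpha> + \<eta>))"

end

theory Submission
  imports Defs
begin

text \<open>
  Let \<open>W\<close> be the linear span of the multiples \<open>x\<^sup>\<eta> f\<^sub>\<alpha>\<close> with \<open>\<eta>\<close> in \<open>\<tau>\<^sub>\<alpha>\<close>. A reduction step subtracts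
  a scalar times such a multiple, so reducing \<open>g\<close> to normal form writes it as an element of \<open>W\<close> plus a
  combination of terms of \<open>N(J)\<close>. The heads \<open>\<alpha> + \<eta>\<close> of these multiples lie in \<open>J\<close>, are pairwise
  distinct because the cones are disjoint, and exceed every other term of their multiple. Hence no
  cancellation can remove a maximal head from a nonzero combination, and \<open>W\<close> meets the span of \<open>N(J)\<close>
  only in \<open>0\<close> (\<open>multiples_independent_of_normal_terms\<close>). So \<open>\<P>\<close> is the direct sum of \<open>W\<close> and
  \<open>\<langle>N(J)\<rangle>\<close>, and \<open>W\<close> lies in the ideal: being a marked basis means that the ideal is contained in \<open>W\<close>.

  If it is a marked basis, every element of the ideal, in particular every S-polynomial, has normal
  form \<open>0\<close>. For the converse, an arbitrary multiple \<open>x\<^sup>\<eta> f\<^sub>\<alpha>\<close> is shown to lie in \<open>W\<close> by well-founded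
  induction on \<open>\<alpha> + \<eta>\<close> (\<open>monom_mult_mem_span\<close>). The term \<open>\<alpha> + \<eta>\<close> lies in some cone, say
  \<open>\<alpha> + \<eta> = \<alpha>' + \<eta>'\<close> with \<open>\<eta>'\<close> in \<open>\<tau>\<^sub>\<alpha>\<^sub>'\<close>, and \<open>x\<^sup>\<eta> f\<^sub>\<alpha> - x\<^sup>\<eta>\<^sup>' f\<^sub>\<alpha>\<^sub>'\<close> is a term times the S-polynomial of
  the pair. It remains to see that this is a combination of multiples of marked polynomials with heads
  below \<open>\<alpha> + \<eta>\<close>:
  \<^item> for a pair whose S-polynomial reduces to \<open>0\<close>, the reduction provides such a combination, since
    the terms of the S-polynomial are below the lcm and the order is compatible with multiplication;
  \<^item> for coprime \<open>\<alpha>\<close> and \<open>\<alpha>'\<close> the S-polynomial is \<open>x\<^sup>\<alpha>\<^sup>' f\<^sub>\<alpha> - x\<^sup>\<alpha> f\<^sub>\<alpha>\<^sub>'\<close>. With the tails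
    \<open>t = f\<^sub>\<alpha> - x\<^sup>\<alpha>\<close> and \<open>t' = f\<^sub>\<alpha>\<^sub>' - x\<^sup>\<alpha>\<^sup>'\<close>, the two copies of \<open>f\<^sub>\<alpha> f\<^sub>\<alpha>\<^sub>'\<close> cancel and leave
    \<open>t f\<^sub>\<alpha>\<^sub>' - t' f\<^sub>\<alpha>\<close>, whose heads are below \<open>\<alpha> + \<alpha>'\<close>.

  This argument compares \<open>\<alpha>\<close> with the tail of \<open>f\<^sub>\<alpha>\<close>, which the order guarantees only if \<open>\<tau>\<^sub>\<alpha>\<close>
  is nonempty. A head \<open>\<alpha>\<close> with \<open>\<tau>\<^sub>\<alpha> = {}\<close> lies in the cone of another head \<open>\<beta>\<close>, and reducing the
  S-polynomial of that pair expresses \<open>f\<^sub>\<alpha>\<close> by marked polynomials covered by the induction; if \<open>\<beta>\<close> is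
  the term \<open>1\<close>, then \<open>f\<^sub>\<beta> = 1\<close> does so already (\<open>marked_mem_span\<close>).
\<close>

section \<open>Linear spans and monomial multiples in the polynomial ring\<close>

abbreviation (input) lookup :: "('b \<Rightarrow>\<^sub>0 'c::zero) \<Rightarrow> 'b \<Rightarrow> 'c" where
  "lookup \<equiv> Poly_Mapping.lookup"

abbreviation (input) keys :: "('b \<Rightarrow>\<^sub>0 'c::zero) \<Rightarrow> 'b set" where
  "keys \<equiv> Poly_Mapping.keys"

abbreviation monom :: "'n pterm \<Rightarrow> ('n, 'a::field) mpoly" where
  "monom t \<equiv> Poly_Mapping.single t 1"

interpretation mpoly: vector_space
  "\<lambda>(c::'a::field) (p::('n, 'a) mpoly). Poly_Mapping.single 0 c * p"
  by (rule vector_space_scale)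

lemmas ideal_span_zero = module.span_zero[OF module_mult]
  and ideal_span_add = module.span_add[OF module_mult]
  and ideal_span_diff = module.span_diff[OF module_mult]
  and ideal_span_mult = module.span_scale[OF module_mult]
  and ideal_span_base = module.span_base[OF module_mult]
  and ideal_span_induct = module.span_induct_alt[OF module_mult, consumes 1, case_names base step]

lemma linear_span_eq: "linear_span V = mpoly.span V"
  by (simp add: linear_span_def)

lemma poly_ideal_eq: "poly_ideal V = module.span (*) V"
  by (simp add: poly_ideal_def)

lemma lookup_scale: "lookup (Poly_Mapping.single 0 c * (p::('n, 'a::field) mpoly)) t = c * lookup p t"
  by (auto simp: mult_map_scale_conv_mult[symmetric] Poly_Mapping.map.rep_eq when_def)

lemma keys_scale: "keys (Poly_Mapping.single 0 c * (p::('n, 'a::field) mpoly)) \<subseteq> keys p"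
  by (auto simp: in_keys_iff lookup_scale)

lemma keys_monom_mult:
  "keys (Poly_Mapping.single s c * (p::('n, 'a::field) mpoly)) \<subseteq> (\<lambda>t. s + t) ` keys p"
  using keys_mult[of "Poly_Mapping.single s c" p] by (auto split: if_splits)

lemma poly_eq_sum_monoms:
  "p = (\<Sum>t\<in>keys p. Poly_Mapping.single 0 (lookup p t) * monom t)" for p :: "('n, 'a::field) mpoly"
proof (rule poly_mapping_eqI)
  fix k
  have "(\<Sum>t\<in>keys p. lookup (Poly_Mapping.single t (lookup p t)) k)
      = (\<Sum>t\<in>keys p. if t = k then lookup p t else 0)"
    by (rule sum.cong) (auto simp: lookup_single when_def)
  also have "\<dots> = lookup p k"
    by (auto simp: sum.delta in_keys_iff)
  finally show "lookup p k = lookup (\<Sum>t\<in>keys p. Poly_Mapping.single 0 (lookup p t) * monom t) k"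
    by (simp add: lookup_sum mult_single)
qed

lemma mem_span_monoms_iff:
  "p \<in> mpoly.span (monom ` T) \<longleftrightarrow> keys p \<subseteq> T" for p :: "('n, 'a::field) mpoly"
proof
  assume "p \<in> mpoly.span (monom ` T)"
  then show "keys p \<subseteq> T"
  proof (induction rule: mpoly.span_induct_alt)
    case (step c x y)
    then have "keys x \<subseteq> T" by auto
    then show ?case
      using step keys_add[of "Poly_Mapping.single 0 c * x" y] keys_scale[of c x] by blast
  qed simp
next
  assume "keys p \<subseteq> T"
  then have "(\<Sum>t\<in>keys p. Poly_Mapping.single 0 (lookup p t) * monom t) \<in> mpoly.span (monom ` T)"
    by (intro mpoly.span_sum mpoly.span_scale mpoly.span_base) auto
  then show "p \<in> mpoly.span (monom ` T)"
    using poly_eq_sum_monoms[of p] by simp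
qed

text \<open>
  Multiplication by \<open>q\<close> is linear, so it suffices to test a spanning set of the domain.
\<close>

lemma mult_mem_span:
  fixes p q :: "('n, 'a::field) mpoly"
  assumes "p \<in> mpoly.span B" and "\<And>b. b \<in> B \<Longrightarrow> q * b \<in> mpoly.span C"
  shows "q * p \<in> mpoly.span C"
  using assms(1)
proof (induction rule: mpoly.span_induct_alt)
  case base
  show ?case by (simp add: mpoly.span_zero)
next
  case (step c x y)
  have "q * (Poly_Mapping.single 0 c * x + y) = Poly_Mapping.single 0 c * (q * x) + q * y"
    by (simp add: algebra_simps)
  then show ?case
    using step assms(2) by (simp add: mpoly.span_add mpoly.span_scale)
qed

lemma mult_mem_span_of_monom_mult:
  fixes p q :: "('n, 'a::field) mpoly"
  assumes "\<And>t. t \<in> keys q \<Longrightarrow> monom t * p \<in> mpoly.span C"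
  shows "q * p \<in> mpoly.span C"
proof -
  have "p * q \<in> mpoly.span C"
  proof (rule mult_mem_span)
    show "q \<in> mpoly.span (monom ` keys q)" by (simp add: mem_span_monoms_iff)
    show "p * b \<in> mpoly.span C" if "b \<in> monom ` keys q" for b
      using that assms by (auto simp: mult.commute[of p])
  qed
  then show ?thesis by (simp add: mult.commute)
qed

text \<open>
  In a linear combination choose a maximal head among the members with nonzero coefficient. No other
  of these members contains it, so it survives as a term of the sum.
\<close>

lemma triangular_family_span_trivial:
  fixes p :: "('n, 'a::field) mpoly"
  assumes "transp prec" and "irreflp prec" and "inj_on head B"
    and head: "\<And>b. b \<in> B \<Longrightarrow> lookup b (head b) \<noteq> 0"
    and below: "\<And>b t. b \<in> B \<Longrightarrow> t \<in> keys b \<Longrightarrow> t \<noteq> head b \<Longrightarrow> prec t (head b)"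
    and "p \<in> mpoly.span B" and "keys p \<inter> head ` B = {}"
  shows "p = 0"
proof -
  obtain r where p: "p = (\<Sum>b | r b \<noteq> 0. Poly_Mapping.single 0 (r b) * b)"
    and fin: "finite {b. r b \<noteq> 0}" and sub: "\<And>b. r b \<noteq> 0 \<Longrightarrow> b \<in> B"
    using \<open>p \<in> mpoly.span B\<close> unfolding mpoly.span_explicit' by blast
  have "{b. r b \<noteq> 0} = {}"
  proof (rule ccontr)
    assume "{b. r b \<noteq> 0} \<noteq> {}"
    moreover have "asymp_on A prec" for A
    proof (rule asymp_onI)
      fix x y assume "prec x y"
      then show "\<not> prec y x"
        using irreflpD[OF assms(2), of x] transpD[OF assms(1), of x y x] by blast
    qed
    moreover have "transp_on A prec" for A
      using transp_on_subset[OF \<open>transp prec\<close> subset_UNIV] .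
    ultimately obtain b where b: "r b \<noteq> 0"
      and max: "\<And>b'. r b' \<noteq> 0 \<Longrightarrow> head b' \<noteq> head b \<Longrightarrow> \<not> prec (head b) (head b')"
      using Finite_Set.bex_max_element[of "head ` {b. r b \<noteq> 0}" prec] fin by auto
    have "lookup p (head b) = (\<Sum>b' | r b' \<noteq> 0. r b' * lookup b' (head b))"
      unfolding p by (simp add: lookup_sum lookup_scale)
    also have "\<dots> = (\<Sum>b' | r b' \<noteq> 0. if b' = b then r b * lookup b (head b) else 0)"
    proof (rule sum.cong)
      fix b' assume b': "b' \<in> {b. r b \<noteq> 0}"
      show "r b' * lookup b' (head b) = (if b' = b then r b * lookup b (head b) else 0)"
      proof (cases "b' = b")
        case False
        then have "head b' \<noteq> head b"
          using \<open>inj_on head B\<close> sub b b' by (auto dest: inj_onD)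
        then have "head b \<notin> keys b'"
          using below[of b' "head b"] max[of b'] sub b' by auto
        then show ?thesis using False by (simp add: in_keys_iff)
      qed simp
    qed simp
    also have "\<dots> = r b * lookup b (head b)"
      using fin b by (simp add: sum.delta)
    finally have "head b \<in> keys p"
      using b head[OF sub[OF b]] by (simp add: in_keys_iff)
    then show False using assms(7) sub[OF b] by blast
  qed
  then show ?thesis using p by simp
qed

section \<open>Least common multiples of terms\<close>

lemma lookup_lcm_term: "lookup (lcm_term s t) i = max (lookup s i) (lookup t i)"
  by (simp add: lcm_term.rep_eq)

lemma lookup_minus_nat: "lookup (s - t) i = lookup s i - lookup t i" for s t :: "'n pterm"
  by (simp add: lookup_minus)

lemma add_lcm_term_minus:
  "s + (lcm_term s t - s) = lcm_term s t" "t + (lcm_term s t - t) = lcm_term s t"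
  by (auto intro!: poly_mapping_eqI simp: lookup_add lookup_minus_nat lookup_lcm_term)

text \<open>
  A common multiple of \<open>s\<close> and \<open>t\<close> exceeds their lcm by one factor \<open>w\<close>, shared by both cofactors. This
  is what turns the difference of two multiples with equal heads into a multiple of an S-polynomial.
\<close>

lemma lcm_term_divides_common_multiple:
  assumes "s + u = t + v"
  obtains w where "s + u = lcm_term s t + w" and "u = lcm_term s t - s + w"
    and "v = lcm_term s t - t + w"
proof
  define w where "w = s + u - lcm_term s t"
  have eq: "lookup s i + lookup u i = lookup t i + lookup v i" for i
    using arg_cong[OF assms, of "\<lambda>p. lookup p i"] by (simp add: lookup_add)
  have "lookup (s + u) i = lookup (lcm_term s t + w) i"
    and "lookup u i = lookup (lcm_term s t - s + w) i"
    and "lookup v i = lookup (lcm_term s t - t + w) i" for i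
    using eq[of i]
    by (simp_all add: w_def lookup_add lookup_minus_nat lookup_lcm_term max_def)
  then show "s + u = lcm_term s t + w" and "u = lcm_term s t - s + w" and "v = lcm_term s t - t + w"
    by (auto intro: poly_mapping_eqI)
qed

lemma lcm_term_of_multiple: "lcm_term (t + u) t = t + u"
  by (rule poly_mapping_eqI) (simp add: lookup_lcm_term lookup_add)

section \<open>Reduction by a marked set\<close>

locale ordered_marked_set =
  fixes J :: "'n red_struct"
    and prec :: "'n pterm \<Rightarrow> 'n pterm \<Rightarrow> bool"
    and f :: "'n pterm \<Rightarrow> ('n, 'a::field) mpoly"
  assumes rs: "reduction_structure J"
    and noeth: "noetherian_rs TYPE('a) J"
    and ord: "ordered_rs J prec"
    and disj: "disjoint_cones J"
    and compat: "prec \<delta>' \<delta> \<Longrightarrow> prec (\<delta>' + \<epsilon>) (\<delta> + \<epsilon>)"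
    and marked: "marked_set J f"
begin

definition tail :: "'n pterm \<Rightarrow> ('n, 'a) mpoly" where
  "tail \<alpha> = f \<alpha> - monom \<alpha>"

text \<open>
  The multiples available to reduction, with head restricted to a set \<open>D\<close> of terms in order to keep
  track of how large the heads used by a reduction are.
\<close>

definition multiples :: "'n pterm set \<Rightarrow> ('n, 'a) mpoly set" where
  "multiples D = {monom \<eta> * f \<alpha> |\<alpha> \<eta>. \<alpha> \<in> heads J \<and> \<eta> \<in> mults J \<alpha> \<and> \<alpha> + \<eta> \<in> D}"

lemma marked_eq: "f \<alpha> = monom \<alpha> + tail \<alpha>"
  by (simp add: tail_def)

lemma transp_prec: "transp prec" and irreflp_prec: "irreflp prec" and wfp_prec: "wfp prec"
  using ord by (auto simp: ordered_rs_def well_founded_order_def)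

lemma keys_tail: "\<alpha> \<in> heads J \<Longrightarrow> keys (tail \<alpha>) \<subseteq> tails J \<alpha>"
  using marked by (simp add: marked_set_def tail_def)

lemma keys_tail_below:
  "\<alpha> \<in> heads J \<Longrightarrow> \<eta> \<in> mults J \<alpha> \<Longrightarrow> \<gamma> \<in> keys (tail \<alpha>) \<Longrightarrow> prec (\<gamma> + \<eta>) (\<alpha> + \<eta>)"
  using ord keys_tail unfolding ordered_rs_def by blast

text \<open>
  A nonempty \<open>\<tau>\<^sub>\<alpha>\<close> contains the term \<open>1\<close>, because it contains all divisors of its members. This is what
  makes the order compare \<open>\<alpha>\<close> itself with the tail of \<open>f\<^sub>\<alpha>\<close>.
\<close>

lemma zero_mem_mults:
  assumes "\<alpha> \<in> heads J" and "mults J \<alpha> \<noteq> {}"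
  shows "0 \<in> mults J \<alpha>"
proof (rule ccontr)
  assume "0 \<notin> mults J \<alpha>"
  moreover have "semigroup_ideal (- mults J \<alpha>)"
    using rs assms(1) by (simp add: reduction_structure_def order_ideal_def)
  ultimately have "0 + t \<notin> mults J \<alpha>" for t
    unfolding semigroup_ideal_def by blast
  then show False using assms(2) by auto
qed

lemma mults_divisor:
  "\<alpha> \<in> heads J \<Longrightarrow> s + t \<in> mults J \<alpha> \<Longrightarrow> s \<in> mults J \<alpha>"
  using rs unfolding reduction_structure_def order_ideal_def semigroup_ideal_def by blast

lemma tail_prec:
  assumes "\<alpha> \<in> heads J" and "mults J \<alpha> \<noteq> {}" and "\<gamma> \<in> keys (tail \<alpha>)"
  shows "prec (\<gamma> + \<epsilon>) (\<alpha> + \<epsilon>)"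
  using compat keys_tail_below[OF assms(1) zero_mem_mults[OF assms(1,2)] assms(3)] by simp

lemma head_multiple_mem_rs_ideal: "\<alpha> \<in> heads J \<Longrightarrow> \<alpha> + \<eta> \<in> rs_ideal J"
  by (auto simp: rs_ideal_def hull_def semigroup_ideal_def)

lemma rs_ideal_cases:
  assumes "t \<in> rs_ideal J"
  obtains \<alpha> \<eta> where "\<alpha> \<in> heads J" and "\<eta> \<in> mults J \<alpha>" and "t = \<alpha> + \<eta>"
  using assms rs unfolding reduction_structure_def rs_cone_def by blast

lemma keys_multiple:
  assumes "\<alpha> \<in> heads J" and "\<eta> \<in> mults J \<alpha>"
  shows "lookup (monom \<eta> * f \<alpha>) (\<alpha> + \<eta>) = 1"
    and "t \<in> keys (monom \<eta> * f \<alpha>) \<Longrightarrow> t = \<alpha> + \<eta> \<or> prec t (\<alpha> + \<eta>)"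
proof -
  have eq: "monom \<eta> * f \<alpha> = monom (\<alpha> + \<eta>) + monom \<eta> * tail \<alpha>"
    by (simp add: marked_eq algebra_simps mult_single)
  have below: "prec t (\<alpha> + \<eta>)" if "t \<in> keys (monom \<eta> * tail \<alpha>)" for t
    using that keys_monom_mult[of \<eta> 1 "tail \<alpha>"] keys_tail_below[OF assms]
    by (auto simp: add.commute)
  then have "\<alpha> + \<eta> \<notin> keys (monom \<eta> * tail \<alpha>)"
    using irreflp_prec by (auto dest: irreflpD)
  then show "lookup (monom \<eta> * f \<alpha>) (\<alpha> + \<eta>) = 1"
    by (simp add: eq lookup_add in_keys_iff)
  show "t = \<alpha> + \<eta> \<or> prec t (\<alpha> + \<eta>)" if "t \<in> keys (monom \<eta> * f \<alpha>)"
    using that below keys_add[of "monom (\<alpha> + \<eta>)" "monom \<eta> * tail \<alpha>"] by (auto simp: eq)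
qed

text \<open>
  The multiples form a triangular family: by disjointness of the cones the head \<open>\<alpha> + \<eta>\<close> determines
  \<open>\<alpha>\<close> and hence \<open>\<eta>\<close>.
\<close>

lemma multiples_independent_of_normal_terms:
  assumes "p \<in> mpoly.span (multiples UNIV)" and "keys p \<subseteq> rs_normal_terms J"
  shows "p = 0"
proof -
  have "\<forall>b\<in>multiples UNIV. \<exists>t. \<exists>\<alpha> \<eta>.
      b = monom \<eta> * f \<alpha> \<and> \<alpha> \<in> heads J \<and> \<eta> \<in> mults J \<alpha> \<and> t = \<alpha> + \<eta>"
    unfolding multiples_def by blast
  \<comment> \<open>A multiple is a bare polynomial, so its head has to be chosen; \<open>b\<close> might a priori arise from
    several pairs \<open>(\<alpha>, \<eta>)\<close>.\<close>
  from bchoice[OF this] obtain head where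
    head: "\<exists>\<alpha> \<eta>. b = monom \<eta> * f \<alpha> \<and> \<alpha> \<in> heads J \<and> \<eta> \<in> mults J \<alpha> \<and> head b = \<alpha> + \<eta>"
    if "b \<in> multiples UNIV" for b
    by blast
  show ?thesis
  proof (rule triangular_family_span_trivial[OF transp_prec irreflp_prec _ _ _ assms(1), of head])
    show "inj_on head (multiples UNIV)"
    proof (rule inj_onI)
      fix b b' assume "b \<in> multiples UNIV" "b' \<in> multiples UNIV" and eq: "head b = head b'"
      then obtain \<alpha> \<eta> \<alpha>' \<eta>' where
        b: "b = monom \<eta> * f \<alpha>" "\<alpha> \<in> heads J" "\<eta> \<in> mults J \<alpha>" "head b = \<alpha> + \<eta>" and
        b': "b' = monom \<eta>' * f \<alpha>'" "\<alpha>' \<in> heads J" "\<eta>' \<in> mults J \<alpha>'" "head b' = \<alpha>' + \<eta>'"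
        using head by meson
      then have "head b \<in> rs_cone J \<alpha>" and "head b \<in> rs_cone J \<alpha>'"
        unfolding rs_cone_def using eq by (smt (verit) mem_Collect_eq)+
      then have "\<alpha> = \<alpha>'" using disj b b' unfolding disjoint_cones_def by blast
      then show "b = b'" using b b' eq by simp
    qed
    show "lookup b (head b) \<noteq> 0" if "b \<in> multiples UNIV" for b
      using head[OF that] keys_multiple(1) by (metis one_neq_zero)
    show "prec t (head b)" if "b \<in> multiples UNIV" "t \<in> keys b" "t \<noteq> head b" for b t
      using head[OF that(1)] keys_multiple(2) that(2,3) by metis
    show "keys p \<inter> head ` multiples UNIV = {}"
      using assms(2) head head_multiple_mem_rs_ideal unfolding rs_normal_terms_def
      by fastforce
  qed
qed

text \<open>
  Noetherianity makes reduction well-founded, and a term of \<open>J\<close> always lies in a cone, so only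
  polynomials supported on \<open>N(J)\<close> are irreducible.
\<close>

lemma reduction_exists: "\<exists>l. reduces_to_nf J f g l"
proof -
  have "\<not> (\<exists>h. \<forall>i::nat. red_step J f (h i) (h (Suc i)))"
    using noeth marked unfolding noetherian_rs_def by blast
  then have "wfp (red_step J f)\<inverse>\<inverse>"
    unfolding wfp_def wf_iff_no_infinite_down_chain by simp
  then show ?thesis
  proof (induction g rule: wfp_induct_rule)
    case (less g)
    show ?case
    proof (cases "keys g \<subseteq> rs_normal_terms J")
      case True
      then show ?thesis unfolding reduces_to_nf_def by blast
    next
      case False
      then obtain \<gamma> where \<gamma>: "\<gamma> \<in> keys g" "\<gamma> \<in> rs_ideal J"
        by (auto simp: rs_normal_terms_def)
      then obtain \<alpha> \<eta> where "\<alpha> \<in> heads J" "\<eta> \<in> mults J \<alpha>" "\<gamma> = \<alpha> + \<eta>"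
        using rs_ideal_cases by metis
      then obtain h where h: "red_step J f g h"
        using \<gamma> unfolding red_step_def by blast
      then obtain l where "reduces_to_nf J f h l" using less by auto
      then show ?thesis
        using h unfolding reduces_to_nf_def by (meson converse_rtranclp_into_rtranclp)
    qed
  qed
qed

text \<open>
  A reduction step at a term \<open>\<gamma>\<close> of \<open>g\<close> replaces it by smaller terms, so a downward closed set that
  contains the support of \<open>g\<close> contains the heads of all multiples that are subtracted.
\<close>

lemma reduction_difference_mem_span:
  assumes "(red_step J f)\<^sup>*\<^sup>* g l" and "keys g \<subseteq> D"
    and down: "\<And>s t. prec s t \<Longrightarrow> t \<in> D \<Longrightarrow> s \<in> D"
  shows "g - l \<in> mpoly.span (multiples D)"
  using assms(1,2)
proof (induction rule: converse_rtranclp_induct)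
  case base
  show ?case by (simp add: mpoly.span_zero)
next
  case (step g h)
  then obtain \<alpha> \<eta> where \<alpha>: "\<alpha> \<in> heads J" "\<eta> \<in> mults J \<alpha>" "\<alpha> + \<eta> \<in> keys g"
    and h: "h = g - Poly_Mapping.single \<eta> (lookup g (\<alpha> + \<eta>)) * f \<alpha>"
    unfolding red_step_def by blast
  define c where "c = lookup g (\<alpha> + \<eta>)"
  define b where "b = monom \<eta> * f \<alpha>"
  have h: "h = g - Poly_Mapping.single 0 c * b"
    by (simp add: h c_def b_def mult_single flip: mult.assoc)
  have "keys b \<subseteq> D"
    unfolding b_def using keys_multiple(2)[OF \<alpha>(1,2)] down \<alpha>(3) step.prems by blast
  moreover have "keys h \<subseteq> keys g \<union> keys b"
    by (auto simp: h in_keys_iff lookup_minus lookup_scale)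
  ultimately have "keys h \<subseteq> D" using step.prems by blast
  then have "h - l \<in> mpoly.span (multiples D)" by (rule step.IH)
  moreover have "b \<in> multiples D"
    using \<alpha> step.prems unfolding multiples_def b_def by blast
  moreover have "g - l = Poly_Mapping.single 0 c * b + (h - l)"
    by (simp add: h)
  ultimately show ?case
    by (metis mpoly.span_add mpoly.span_scale mpoly.span_base)
qed

section \<open>The ideal generated by a marked set\<close>

lemma mult_marked_mem_ideal: "\<alpha> \<in> heads J \<Longrightarrow> q * f \<alpha> \<in> poly_ideal (f ` heads J)"
  unfolding poly_ideal_eq by (intro ideal_span_mult ideal_span_base) blast

lemma span_multiples_subset_ideal: "mpoly.span (multiples D) \<subseteq> poly_ideal (f ` heads J)"
proof
  fix p assume "p \<in> mpoly.span (multiples D)"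
  then show "p \<in> poly_ideal (f ` heads J)"
  proof (induction rule: mpoly.span_induct_alt)
    case base
    show ?case by (simp add: poly_ideal_eq ideal_span_zero)
  next
    case (step c x y)
    then have "x \<in> poly_ideal (f ` heads J)"
      using mult_marked_mem_ideal by (auto simp: multiples_def)
    then show ?case
      using step by (simp add: poly_ideal_eq ideal_span_add ideal_span_mult)
  qed
qed

lemma S_poly_mem_ideal:
  "\<alpha> \<in> heads J \<Longrightarrow> \<alpha>' \<in> heads J \<Longrightarrow> S_poly f \<alpha>' \<alpha> \<in> poly_ideal (f ` heads J)"
  using mult_marked_mem_ideal unfolding S_poly_def poly_ideal_eq by (blast intro: ideal_span_diff)

text \<open>
  A normal form of an element of the ideal is again in the ideal, so it lies in both summands.
\<close>

lemma marked_basis_reduces_to_zero: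
  assumes "marked_basis J f" and "g \<in> poly_ideal (f ` heads J)"
  shows "reduces_to_nf J f g 0"
proof -
  obtain l where l: "reduces_to_nf J f g l" using reduction_exists by blast
  have "g - l \<in> poly_ideal (f ` heads J)"
    using l reduction_difference_mem_span[of g l UNIV] span_multiples_subset_ideal
    unfolding reduces_to_nf_def by blast
  then have "g - (g - l) \<in> poly_ideal (f ` heads J)"
    using assms(2) unfolding poly_ideal_eq by (rule ideal_span_diff[rotated])
  moreover have "l \<in> linear_span (monom ` rs_normal_terms J)"
    using l by (simp add: linear_span_eq mem_span_monoms_iff reduces_to_nf_def)
  ultimately have "l = 0"
    using assms(1) by (auto simp: marked_basis_def is_direct_sum_def)
  then show ?thesis using l by simp
qed

text \<open>
  Reduction shows that the sum is everything; it is direct because no nonzero combination of the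
  multiples is supported on \<open>N(J)\<close>.
\<close>

lemma marked_basisI:
  assumes "poly_ideal (f ` heads J) \<subseteq> mpoly.span (multiples UNIV)"
  shows "marked_basis J f"
proof -
  let ?I = "poly_ideal (f ` heads J)" and ?N = "linear_span (monom ` rs_normal_terms J)"
  have "p = 0" if "p \<in> ?I" "p \<in> ?N" for p
    using that assms multiples_independent_of_normal_terms[of p]
    by (auto simp: linear_span_eq mem_span_monoms_iff)
  moreover have "0 \<in> ?I \<inter> ?N"
    by (simp add: linear_span_eq poly_ideal_eq mpoly.span_zero ideal_span_zero)
  moreover have "\<exists>u v. g = u + v \<and> u \<in> ?I \<and> v \<in> ?N" for g
  proof -
    obtain l where l: "reduces_to_nf J f g l" using reduction_exists by blast
    then have "g - l \<in> ?I"
      using reduction_difference_mem_span[of g l UNIV] span_multiples_subset_ideal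
      unfolding reduces_to_nf_def by blast
    moreover have "l \<in> ?N"
      using l by (simp add: linear_span_eq mem_span_monoms_iff reduces_to_nf_def)
    ultimately show ?thesis by (intro exI[of _ "g - l"] exI[of _ l]) simp
  qed
  ultimately show ?thesis unfolding marked_basis_def is_direct_sum_def by blast
qed

section \<open>The Buchberger criterion with coprime pairs discarded\<close>

definition noncoprime_pairs_reduce :: bool where
  "noncoprime_pairs_reduce \<longleftrightarrow> (\<forall>\<alpha>\<in>heads J. \<forall>\<alpha>'\<in>heads J.
     lcm_term \<alpha> \<alpha>' \<in> rs_cone J \<alpha>' \<and> lcm_term \<alpha> \<alpha>' \<noteq> \<alpha> + \<alpha>' \<longrightarrow>
     reduces_to_nf J f (S_poly f \<alpha>' \<alpha>) 0)"

text \<open>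
  The two copies of the lcm cancel, leaving multiples of the tails.
\<close>

lemma keys_S_poly:
  assumes "\<alpha> \<in> heads J" "mults J \<alpha> \<noteq> {}" "\<alpha>' \<in> heads J" "mults J \<alpha>' \<noteq> {}"
    and "t \<in> keys (S_poly f \<alpha>' \<alpha>)"
  shows "prec t (lcm_term \<alpha> \<alpha>')"
proof -
  define u v where "u = lcm_term \<alpha> \<alpha>' - \<alpha>" and "v = lcm_term \<alpha> \<alpha>' - \<alpha>'"
  have uv: "\<alpha> + u = lcm_term \<alpha> \<alpha>'" "\<alpha>' + v = lcm_term \<alpha> \<alpha>'"
    unfolding u_def v_def by (rule add_lcm_term_minus)+
  have "monom u * monom \<alpha> = (monom v * monom \<alpha>' :: ('n, 'a) mpoly)"
    using uv by (simp add: mult_single add.commute)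
  then have "S_poly f \<alpha>' \<alpha> = monom u * tail \<alpha> - monom v * tail \<alpha>'"
    unfolding S_poly_def u_def[symmetric] v_def[symmetric] by (simp add: marked_eq algebra_simps)
  then have "t \<in> keys (monom u * tail \<alpha>) \<or> t \<in> keys (monom v * tail \<alpha>')"
    using assms(5) by (auto simp: in_keys_iff lookup_minus)
  then show ?thesis
    using keys_monom_mult[of u 1 "tail \<alpha>"] keys_monom_mult[of v 1 "tail \<alpha>'"]
      tail_prec[OF assms(1,2), of _ u] tail_prec[OF assms(3,4), of _ v] uv
    by (auto simp: add.commute)
qed

text \<open>
  The induction described at the beginning; the restriction to nonempty \<open>\<tau>\<^sub>\<alpha>\<close> is inherited by all
  marked polynomials to which the induction hypothesis is applied.
\<close>

lemma monom_mult_mem_span: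
  assumes pairs: noncoprime_pairs_reduce
    and "\<alpha> \<in> heads J" and "mults J \<alpha> \<noteq> {}"
  shows "monom \<eta> * f \<alpha> \<in> mpoly.span (multiples UNIV)"
  using wfp_prec assms(2,3)
proof (induction "\<alpha> + \<eta>" arbitrary: \<alpha> \<eta> rule: wfp_induct_rule)
  case less
  note \<alpha> = less.prems
  have IH: "monom u * f \<beta> \<in> mpoly.span (multiples UNIV)"
    if "prec (\<beta> + u) (\<alpha> + \<eta>)" "\<beta> \<in> heads J" "mults J \<beta> \<noteq> {}" for \<beta> u
    using less.hyps that by blast
  obtain \<alpha>' \<eta>' where \<alpha>': "\<alpha>' \<in> heads J" "\<eta>' \<in> mults J \<alpha>'" and eq: "\<alpha> + \<eta> = \<alpha>' + \<eta>'"
    using rs_ideal_cases[OF head_multiple_mem_rs_ideal[OF \<alpha>(1)]] by metis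
  then have ne: "mults J \<alpha>' \<noteq> {}" by blast
  obtain w where w: "\<alpha> + \<eta> = lcm_term \<alpha> \<alpha>' + w" "\<eta> = lcm_term \<alpha> \<alpha>' - \<alpha> + w"
    "\<eta>' = lcm_term \<alpha> \<alpha>' - \<alpha>' + w"
    by (rule lcm_term_divides_common_multiple[OF eq])
  have S: "monom \<eta> * f \<alpha> = monom \<eta>' * f \<alpha>' + monom w * S_poly f \<alpha>' \<alpha>"
  proof -
    have "monom (u + w) = monom w * (monom u :: ('n, 'a) mpoly)" for u
      by (simp add: mult_single add.commute)
    then have "monom \<eta> = monom w * (monom (lcm_term \<alpha> \<alpha>' - \<alpha>) :: ('n, 'a) mpoly)"
      and "monom \<eta>' = monom w * (monom (lcm_term \<alpha> \<alpha>' - \<alpha>') :: ('n, 'a) mpoly)"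
      using w(2,3) by metis+
    then show ?thesis by (simp add: S_poly_def right_diff_distrib mult.assoc)
  qed
  have "monom w * S_poly f \<alpha>' \<alpha> \<in> mpoly.span (multiples UNIV)"
  proof (cases "lcm_term \<alpha> \<alpha>' = \<alpha> + \<alpha>'")
    case True
    then have S': "S_poly f \<alpha>' \<alpha> = tail \<alpha> * f \<alpha>' - tail \<alpha>' * f \<alpha>"
      by (simp add: S_poly_def tail_def algebra_simps)
    \<comment> \<open>Each product is expanded along its tail factor; a term \<open>t\<close> of the tail is below the head it
      replaces in \<open>\<alpha> + \<alpha>' + w\<close>.\<close>
    have "tail \<alpha> * (monom w * f \<alpha>') \<in> mpoly.span (multiples UNIV)"
    proof (rule mult_mem_span_of_monom_mult)
      fix t assume "t \<in> keys (tail \<alpha>)"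
      then have "prec (t + (\<alpha>' + w)) (\<alpha> + (\<alpha>' + w))" by (rule tail_prec[OF \<alpha>])
      then have "monom (t + w) * f \<alpha>' \<in> mpoly.span (multiples UNIV)"
        using w(1) True by (intro IH[OF _ \<alpha>'(1) ne]) (simp add: ac_simps)
      then show "monom t * (monom w * f \<alpha>') \<in> mpoly.span (multiples UNIV)"
        by (simp add: mult_single flip: mult.assoc)
    qed
    moreover have "tail \<alpha>' * (monom w * f \<alpha>) \<in> mpoly.span (multiples UNIV)"
    proof (rule mult_mem_span_of_monom_mult)
      fix t assume "t \<in> keys (tail \<alpha>')"
      then have "prec (t + (\<alpha> + w)) (\<alpha>' + (\<alpha> + w))" by (rule tail_prec[OF \<alpha>'(1) ne])
      then have "monom (t + w) * f \<alpha> \<in> mpoly.span (multiples UNIV)"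
        using w(1) True by (intro IH[OF _ \<alpha>]) (simp add: ac_simps)
      then show "monom t * (monom w * f \<alpha>) \<in> mpoly.span (multiples UNIV)"
        by (simp add: mult_single flip: mult.assoc)
    qed
    moreover have "monom w * S_poly f \<alpha>' \<alpha>
        = tail \<alpha> * (monom w * f \<alpha>') - tail \<alpha>' * (monom w * f \<alpha>)"
      by (simp add: S' algebra_simps)
    ultimately show ?thesis by (simp add: mpoly.span_diff)
  next
    case False
    \<comment> \<open>Bounding the heads in the reduction strictly by the lcm keeps them, after multiplication by
      \<open>w\<close>, within reach of the induction hypothesis.\<close>
    let ?D = "{t. prec t (lcm_term \<alpha> \<alpha>')}"
    have "lcm_term \<alpha> \<alpha>' - \<alpha>' \<in> mults J \<alpha>'"
      using \<alpha>' w(3) mults_divisor by metis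
    then have "lcm_term \<alpha> \<alpha>' \<in> rs_cone J \<alpha>'"
      unfolding rs_cone_def using add_lcm_term_minus(2)[of \<alpha>' \<alpha>] by (smt (verit) mem_Collect_eq)
    then have "(red_step J f)\<^sup>*\<^sup>* (S_poly f \<alpha>' \<alpha>) 0"
      using pairs False \<alpha>(1) \<alpha>'(1) unfolding noncoprime_pairs_reduce_def reduces_to_nf_def by blast
    then have "S_poly f \<alpha>' \<alpha> - 0 \<in> mpoly.span (multiples ?D)"
      using keys_S_poly[OF \<alpha> \<alpha>'(1) ne] transp_prec
      by (intro reduction_difference_mem_span) (auto dest: transpD)
    then have "S_poly f \<alpha>' \<alpha> \<in> mpoly.span (multiples ?D)" by simp
    then show ?thesis
    proof (rule mult_mem_span)
      fix b assume "b \<in> multiples ?D"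
      then obtain \<beta> u where b: "b = monom u * f \<beta>" and \<beta>: "\<beta> \<in> heads J" "u \<in> mults J \<beta>"
        and "prec (\<beta> + u) (lcm_term \<alpha> \<alpha>')"
        unfolding multiples_def by blast
      then have "prec (\<beta> + u + w) (lcm_term \<alpha> \<alpha>' + w)" by (intro compat)
      then have "monom (u + w) * f \<beta> \<in> mpoly.span (multiples UNIV)"
        using \<beta> w(1) by (intro IH) (auto simp: ac_simps)
      then show "monom w * b \<in> mpoly.span (multiples UNIV)"
        by (simp add: b mult_single add.commute flip: mult.assoc)
    qed
  qed
  moreover have "monom \<eta>' * f \<alpha>' \<in> mpoly.span (multiples UNIV)"
    using \<alpha>' by (intro mpoly.span_base) (auto simp: multiples_def)
  ultimately show ?case by (simp add: S mpoly.span_add)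
qed

lemma mult_mem_span_multiples:
  assumes noncoprime_pairs_reduce and "p \<in> mpoly.span (multiples UNIV)"
  shows "q * p \<in> mpoly.span (multiples UNIV)"
proof (rule mult_mem_span_of_monom_mult, rule mult_mem_span[OF assms(2)])
  fix t b assume "b \<in> multiples UNIV"
  then obtain \<beta> u where "b = monom u * f \<beta>" "\<beta> \<in> heads J" "mults J \<beta> \<noteq> {}"
    unfolding multiples_def by blast
  then show "monom t * b \<in> mpoly.span (multiples UNIV)"
    using monom_mult_mem_span[OF assms(1), of \<beta> "t + u"] by (simp add: mult_single flip: mult.assoc)
qed

text \<open>
  Compatibility with multiplication would make the powers of such a \<open>\<gamma>\<close> an infinite descending chain.
\<close>

lemma no_term_below_one: "\<not> prec \<gamma> 0"
proof
  assume *: "prec \<gamma> 0"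
  have "wf {(x, y). prec x y}" using wfp_prec by (simp add: wfp_def)
  moreover have "(((+) \<gamma> ^^ Suc i) 0, ((+) \<gamma> ^^ i) 0) \<in> {(x, y). prec x y}" for i
    using compat[OF *, of "((+) \<gamma> ^^ i) 0"] by simp
  ultimately show False
    using wf_no_infinite_down_chainE[of _ "\<lambda>i. ((+) \<gamma> ^^ i) 0"] by blast
qed

text \<open>
  If \<open>\<tau>\<^sub>\<alpha>\<close> is empty, then \<open>\<alpha>\<close> is a multiple of a head \<open>\<beta>\<close> in whose cone it lies. The lcm of the two is
  \<open>\<alpha>\<close>, so the pair is among those assumed to reduce unless \<open>\<beta> = 0\<close>; the latter forces \<open>f\<^sub>\<beta> = 1\<close>,
  since no term is below \<open>1\<close>.
\<close>

lemma marked_mem_span: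
  assumes pairs: noncoprime_pairs_reduce and \<alpha>: "\<alpha> \<in> heads J"
  shows "f \<alpha> \<in> mpoly.span (multiples UNIV)"
proof (cases "mults J \<alpha> = {}")
  case False
  then show ?thesis using monom_mult_mem_span[OF assms, of 0] by simp
next
  case True
  obtain \<beta> \<eta> where \<beta>: "\<beta> \<in> heads J" "\<eta> \<in> mults J \<beta>" and eq: "\<alpha> + 0 = \<beta> + \<eta>"
    using rs_ideal_cases[OF head_multiple_mem_rs_ideal[OF \<alpha>]] by metis
  have \<beta>_mem: "q * f \<beta> \<in> mpoly.span (multiples UNIV)" for q
  proof (rule mult_mem_span_of_monom_mult)
    show "monom t * f \<beta> \<in> mpoly.span (multiples UNIV)" for t
      using \<beta> by (intro monom_mult_mem_span[OF pairs]) auto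
  qed
  show ?thesis
  proof (cases "\<beta> = 0")
    case b0: True
    have "keys (tail \<beta>) = {}"
      using tail_prec[OF \<beta>(1), of _ 0] \<beta>(2) no_term_below_one unfolding b0 by fastforce
    then have "f \<beta> = 1" using marked_eq[of \<beta>] b0 by simp
    then show ?thesis using \<beta>_mem[of "f \<alpha>"] by simp
  next
    case False
    have lcm: "lcm_term \<alpha> \<beta> = \<alpha>" using eq by (simp add: lcm_term_of_multiple)
    then have "reduces_to_nf J f (S_poly f \<beta> \<alpha>) 0"
      using pairs \<alpha> \<beta> eq False unfolding noncoprime_pairs_reduce_def rs_cone_def by fastforce
    then have "S_poly f \<beta> \<alpha> - 0 \<in> mpoly.span (multiples UNIV)"
      unfolding reduces_to_nf_def by (intro reduction_difference_mem_span) auto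
    moreover have "f \<alpha> = S_poly f \<beta> \<alpha> + monom (\<alpha> - \<beta>) * f \<beta>"
      by (simp add: S_poly_def lcm)
    ultimately show ?thesis using \<beta>_mem mpoly.span_add by (metis diff_zero)
  qed
qed

lemma marked_basis_iff_noncoprime_pairs_reduce:
  "marked_basis J f \<longleftrightarrow> noncoprime_pairs_reduce"
proof
  assume "marked_basis J f"
  then show noncoprime_pairs_reduce
    using marked_basis_reduces_to_zero S_poly_mem_ideal unfolding noncoprime_pairs_reduce_def by blast
next
  assume pairs: noncoprime_pairs_reduce
  have "p \<in> mpoly.span (multiples UNIV)" if "p \<in> poly_ideal (f ` heads J)" for p
    using that unfolding poly_ideal_eq
  proof (induction rule: ideal_span_induct)
    case base
    show ?case by (simp add: mpoly.span_zero)
  next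
    case (step c x y)
    then show ?case
      using mult_mem_span_multiples[OF pairs] marked_mem_span[OF pairs] by (auto intro: mpoly.span_add)
  qed
  then show "marked_basis J f" by (intro marked_basisI) blast
qed

end

theorem proposition9p3:
  fixes J :: "'n::finite red_struct"
    and prec :: "'n pterm \<Rightarrow> 'n pterm \<Rightarrow> bool"
    and f :: "'n pterm \<Rightarrow> ('n, 'a::field) mpoly"
  assumes "reduction_structure J"
    and "noetherian_rs TYPE('a) J"
    and "ordered_rs J prec"
    and "disjoint_cones J"
    and "\<And>\<delta> \<delta>' \<epsilon>. prec \<delta>' \<delta> \<Longrightarrow>
           prec (\<delta>' + \<epsilon>) (\<delta> + \<epsilon>) \<and> (prec \<epsilon> (\<delta>' + \<epsilon>) \<or> \<epsilon> = \<delta>' + \<epsilon>)"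
    and "marked_set J f"
  shows "marked_basis J f \<longleftrightarrow>
    (\<forall>\<alpha>\<in>heads J. \<forall>\<alpha>'\<in>heads J.
       lcm_term \<alpha> \<alpha>' \<in> rs_cone J \<alpha>' \<and> lcm_term \<alpha> \<alpha>' \<noteq> \<alpha> + \<alpha>' \<longrightarrow>
       reduces_to_nf J f (S_poly f \<alpha>' \<alpha>) 0)"
proof -
  interpret ordered_marked_set J prec f
    using assms by unfold_locales auto
  show ?thesis
    using marked_basis_iff_noncoprime_pairs_reduce unfolding noncoprime_pairs_reduce_def .
qed

end
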